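(* Let $(X,p)$ be a partial metric space, let $\mathcal{I}$ be a non-trivial admissible ideal of $\mathbb{N}$ and let $r>0$. If a sequence $\{\xi_n\}$ in $X$ is $\mathcal{I}$-statistically convergent to $\xi\in X$, then $\{\eta\in\overline{B^{p}_{r}}(\xi):p(\xi,\xi)=p(\eta,\eta)\}\subset\mathcal{I}\text{-}st\text{-}LIM^{r}\xi_n$.
   Context: A partial metric on a non-empty set $X$ is a function $p:X\times X\to[0,\infty)$ such that for all $x,y,z\in X$: (p1) $0\le p(x,x)\le p(x,y)$; (p2) $x=y$ if and only if $p(x,x)=p(x,y)=p(y,y)$; (p3) $p(x,y)=p(y,x)$; (p4) $p(x,y)\le p(x,z)+p(z,y)-p(z,z)$. Then $(X,p)$ is called a partial metric space. The closed ball with center $x\in X$ and radius $r>0$ is $\overline{B^{p}_{r}}(x)=\{y\in X:p(x,y)\le p(x,x)+r\}$. An ideal of $\mathbb{N}$ is a family $\mathcal{I}\subset 2^{\mathbb{N}}$ containing $\emptyset$, closed under finite unions and under taking subsets; it is non-trivial if $\mathcal{I}\ne 2^{\mathbb{N}}$ and $\mathcal{I}\neq\{\emptyset\}$, and a non-trivial ideal is admissible if $\{n\}\in\mathcal{I}$ for every $n\in\mathbb{N}$. A sequence $\{\xi_n\}$ in $X$ is rough $\mathcal{I}$-statistically convergent to $\xi\in X$ of roughness degree $r\ge 0$ if for every $\varepsilon>0$ and $\delta>0$, $\left\{n\in\mathbb{N}:\frac{1}{n}\left|\{k\le n:|p(\xi_k,\xi)-p(\xi,\xi)|\ge r+\varepsilon\}\right|\ge\delta\right\}\in\mathcal{I}$.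 When $r=0$ this is called $\mathcal{I}$-statistical convergence to $\xi$. The set of all $\xi\in X$ to which $\{\xi_n\}$ is rough $\mathcal{I}$-statistically convergent of roughness degree $r$ is denoted $\mathcal{I}\text{-}st\text{-}LIM^{r}\xi_n$. *)

theory Defs
  imports "HOL-Analysis.Analysis"
begin

locale partial_metric_space =
  fixes X :: "'a set" and p :: "'a \<Rightarrow> 'a \<Rightarrow> real"
  assumes nonempty: "X \<noteq> {}"
    and self_nonneg: "x \<in> X \<Longrightarrow> 0 \<le> p x x"
    and self_le: "x \<in> X \<Longrightarrow> y \<in> X \<Longrightarrow> p x x \<le> p x y"
    and eq_iff: "x \<in> X \<Longrightarrow> y \<in> X \<Longrightarrow> x = y \<longleftrightarrow> p x x = p x y \<and> p x y = p y y"
    and commute: "x \<in> X \<Longrightarrow> y \<in> X \<Longrightarrow> p x y = p y x"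
    and triangle: "x \<in> X \<Longrightarrow> y \<in> X \<Longrightarrow> z \<in> X \<Longrightarrow> p x y \<le> p x z + p z y - p z z"

definition pm_cball :: "'a set \<Rightarrow> ('a \<Rightarrow> 'a \<Rightarrow> real) \<Rightarrow> real \<Rightarrow> 'a \<Rightarrow> 'a set" where
  "pm_cball X p r x = {y \<in> X. p x y \<le> p x x + r}"

text \<open>
  The index set of sequences, and the ground set of ideals, is the set of positive integers,
  \<open>{1..}\<close> in type \<^typ>\<open>nat\<close>. The value of a sequence at \<open>0\<close> is never used.
\<close>

definition ideal_of_sets :: "'i set \<Rightarrow> 'i set set \<Rightarrow> bool" where
  "ideal_of_sets S I \<longleftrightarrow> I \<subseteq> Pow S \<and> {} \<in> I \<and>
     (\<forall>A\<in>I. \<forall>B\<in>I. A \<union> B \<in> I) \<and> (\<forall>A\<in>I. \<forall>B. B \<subseteq> A \<longrightarrow> B \<in> I)"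

definition nontrivial_ideal :: "'i set \<Rightarrow> 'i set set \<Rightarrow> bool" where
  "nontrivial_ideal S I \<longleftrightarrow> ideal_of_sets S I \<and> I \<noteq> Pow S \<and> I \<noteq> {{}}"

definition admissible_ideal :: "'i set \<Rightarrow> 'i set set \<Rightarrow> bool" where
  "admissible_ideal S I \<longleftrightarrow> nontrivial_ideal S I \<and> (\<forall>n\<in>S. {n} \<in> I)"

definition rough_I_st_convergent ::
    "('a \<Rightarrow> 'a \<Rightarrow> real) \<Rightarrow> nat set set \<Rightarrow> real \<Rightarrow> (nat \<Rightarrow> 'a) \<Rightarrow> 'a \<Rightarrow> bool" where
  "rough_I_st_convergent p I r \<xi> x \<longleftrightarrow>
     (\<forall>\<epsilon>>0. \<forall>\<delta>>0.
        {n \<in> {1..}. 1 / real n * real (card {k \<in> {1..n}. \<bar>p (\<xi> k) x - p x x\<bar> \<ge> r + \<epsilon>}) \<ge> \<delta>} \<in> I)"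

definition I_st_convergent ::
    "('a \<Rightarrow> 'a \<Rightarrow> real) \<Rightarrow> nat set set \<Rightarrow> (nat \<Rightarrow> 'a) \<Rightarrow> 'a \<Rightarrow> bool" where
  "I_st_convergent p I \<xi> x \<longleftrightarrow> rough_I_st_convergent p I 0 \<xi> x"

definition I_st_LIM ::
    "'a set \<Rightarrow> ('a \<Rightarrow> 'a \<Rightarrow> real) \<Rightarrow> nat set set \<Rightarrow> real \<Rightarrow> (nat \<Rightarrow> 'a) \<Rightarrow> 'a set" where
  "I_st_LIM X p I r \<xi> = {x \<in> X. rough_I_st_convergent p I r \<xi> x}"

end

theory Submission
  imports Defs
begin

text \<open>Replacing the limit \<open>x\<close> by a point \<open>y\<close> of the ball with the
  same self-distance increases the deviation of any point from the limit by at most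
  \<open>r\<close>. Hence indices that are bad for \<open>y\<close> at threshold
  \<open>r + \<epsilon>\<close> are already bad for \<open>x\<close> at threshold
  \<open>\<epsilon>\<close>. This inclusion passes to the counting ratios and then to the sets of
  \<open>n\<close> where they reach \<open>\<delta>\<close>; an ideal is closed under
  subsets.\<close>

theorem theorem3p3:
  fixes X :: "'a set" and p :: "'a \<Rightarrow> 'a \<Rightarrow> real"
    and I :: "nat set set" and r :: real
    and \<xi> :: "nat \<Rightarrow> 'a" and x :: 'a
  assumes "partial_metric_space X p"
    and "admissible_ideal {1..} I"
    and "r > 0"
    and "\<forall>n\<ge>1. \<xi> n \<in> X"
    and "x \<in> X"
    and "I_st_convergent p I \<xi> x"
  shows "{y \<in> pm_cball X p r x. p x x = p y y} \<subseteq> I_st_LIM X p I r \<xi>"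
proof
  interpret partial_metric_space X p by fact
  fix y assume "y \<in> {y \<in> pm_cball X p r x. p x x = p y y}"
  then have y: "y \<in> X" "p x y \<le> p x x + r" "p x x = p y y"
    by (auto simp: pm_cball_def)
  \<comment> \<open>The triangle inequality through \<open>x\<close> and the ball condition give
    \<open>p z y \<le> p z x + r\<close>; then subtract the common self-distance. The left absolute
    value is harmless since \<open>p y y \<le> p z y\<close>.\<close>
  have excess: "\<bar>p z y - p y y\<bar> \<le> \<bar>p z x - p x x\<bar> + r" if "z \<in> X" for z
    using triangle[of z y x] self_le[of y z] commute[of y z] that y \<open>x \<in> X\<close> by linarith
  have "rough_I_st_convergent p I r \<xi> y"
    unfolding rough_I_st_convergent_def
  proof (intro allI impI)
    fix \<epsilon> \<delta> :: real assume "\<epsilon> > 0" "\<delta> > 0"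
    \<comment> \<open>With \<open>s\<close> as a parameter, \<open>s = 0\<close> yields the literal
      \<open>0 + \<epsilon>\<close> of the unfolded hypothesis on \<open>x\<close>, and
      \<open>s = r\<close> yields the goal for \<open>y\<close>.\<close>
    let ?K = "\<lambda>s z n. {k \<in> {1..n}. \<bar>p (\<xi> k) z - p z z\<bar> \<ge> s + \<epsilon>}"
    let ?N = "\<lambda>s z. {n \<in> {1..}. 1 / real n * real (card (?K s z n)) \<ge> \<delta>}"
    have "?K r y n \<subseteq> ?K 0 x n" for n
    proof
      fix k assume k: "k \<in> ?K r y n"
      with assms(4) have "\<xi> k \<in> X" by simp
      from excess[OF this] k show "k \<in> ?K 0 x n" by auto
    qed
    then have "card (?K r y n) \<le> card (?K 0 x n)" for n
      by (intro card_mono) auto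
    then have "1 / real n * real (card (?K r y n)) \<le> 1 / real n * real (card (?K 0 x n))" for n
      by (intro mult_left_mono) auto
    then have "?N r y \<subseteq> ?N 0 x"
      using order_trans by blast
    moreover have "?N 0 x \<in> I"
      using assms(6) \<open>\<epsilon> > 0\<close> \<open>\<delta> > 0\<close>
      unfolding I_st_convergent_def rough_I_st_convergent_def by blast
    ultimately show "?N r y \<in> I"
      using assms(2)
      unfolding admissible_ideal_def nontrivial_ideal_def ideal_of_sets_def by blast
  qed
  with y show "y \<in> I_st_LIM X p I r \<xi>"
    by (simp add: I_st_LIM_def)
qed

end
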